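(* Let $V$ be a real inner-product space of finite dimension $n \ge 1$. Given any conformal $T \in GL(V)$, we can write $$T = D\circ \mathcal{R}\circ R_{n-2}\circ R_{n-3}\circ\dots\circ R_2\circ R_1,$$ where $R_k$ is a rotational operator on $V$ for each $k\in\{1,2,\ldots,n-2\}$, $\mathcal{R}$ is either a rotational or a reflectional operator on $V$, and $D$ is a scalar operator on $V$.
   Context: Throughout, $V$ is a real inner-product space of dimension $n\in\mathbb{N}$, $n\ge1$, and $GL(V)$ is the set of invertible linear operators on $V$. When $n\le 2$ the list $R_1,\dots,R_{n-2}$ is empty and the decomposition reads $T=D\circ\mathcal{R}$. Conformal: a linear $f:V\to V$ is conformal if there is a real $\lambda>0$ such that $\langle f(u),f(v)\rangle=\lambda\langle u,v\rangle$ for all $u,v\in V$. Scalar operator: a real multiple of the identity operator. Let $W$ be a two-dimensional subspace of $V$ with orthonormal basis $\{u,v\}$. For a fixed real $\theta$, the linear operator on $W$ determined by $u\mapsto(\cos\theta)u+(\sin\theta)v$, $v\mapsto(-\sin\theta)u+(\cos\theta)v$ is called a rotation of $W$; the linear operator on $W$ determined by $u\mapsto u$, $v\mapsto -v$ is called a reflection of $W$. A linear operator on $V$ of the form $\rho\oplus\mathrm{id}$, where $\rho$ is an operator on some two-dimensional subspace $W$ of $V$ and $\mathrm{id}$ is the identity on $W^\perp$, is called a rotational operator (planar rotation) if $\rho$ is a rotation of $W$, and a reflectional operator (planar reflection) if $\rho$ is a reflection of $W$. When $\dim V=1$, the identity operator on $V$ is also called a rotational operator. *)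

theory Defs
  imports "HOL-Analysis.Analysis"
begin

definition conformal :: "('a::real_inner \<Rightarrow> 'a) \<Rightarrow> bool" where
  "conformal f \<longleftrightarrow> linear f \<and> (\<exists>c>0. \<forall>u v. inner (f u) (f v) = c * inner u v)"

definition in_GL :: "('a::real_vector \<Rightarrow> 'a) \<Rightarrow> bool" where
  "in_GL f \<longleftrightarrow> linear f \<and> bij f"

definition scalar_operator :: "('a::real_vector \<Rightarrow> 'a) \<Rightarrow> bool" where
  "scalar_operator f \<longleftrightarrow> (\<exists>c::real. f = (\<lambda>x. c *\<^sub>R x))"

text \<open>An operator on a subspace \<open>W\<close> is represented by a function on the whole type,
  of which only the values on \<open>W\<close> are relevant.\<close>

definition linear_operator_on :: "'a::real_vector set \<Rightarrow> ('a \<Rightarrow> 'a) \<Rightarrow> bool" where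
  "linear_operator_on W \<rho> \<longleftrightarrow>
     (\<forall>x\<in>W. \<rho> x \<in> W) \<and>
     (\<forall>x\<in>W. \<forall>y\<in>W. \<rho> (x + y) = \<rho> x + \<rho> y) \<and>
     (\<forall>c. \<forall>x\<in>W. \<rho> (c *\<^sub>R x) = c *\<^sub>R \<rho> x)"

definition orthonormal_basis_pair :: "'a::real_inner set \<Rightarrow> 'a \<Rightarrow> 'a \<Rightarrow> bool" where
  "orthonormal_basis_pair W u v \<longleftrightarrow>
     norm u = 1 \<and> norm v = 1 \<and> inner u v = 0 \<and> span {u, v} = W"

definition rotation_of :: "'a::real_inner set \<Rightarrow> ('a \<Rightarrow> 'a) \<Rightarrow> bool" where
  "rotation_of W \<rho> \<longleftrightarrow> linear_operator_on W \<rho> \<and>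
     (\<exists>u v \<theta>. orthonormal_basis_pair W u v \<and>
        \<rho> u = cos \<theta> *\<^sub>R u + sin \<theta> *\<^sub>R v \<and>
        \<rho> v = (- sin \<theta>) *\<^sub>R u + cos \<theta> *\<^sub>R v)"

definition reflection_of :: "'a::real_inner set \<Rightarrow> ('a \<Rightarrow> 'a) \<Rightarrow> bool" where
  "reflection_of W \<rho> \<longleftrightarrow> linear_operator_on W \<rho> \<and>
     (\<exists>u v. orthonormal_basis_pair W u v \<and> \<rho> u = u \<and> \<rho> v = - v)"

text \<open>\<open>f = \<rho> \<oplus> id\<close> with respect to the decomposition of the space into \<open>W\<close> and its
  orthogonal complement.\<close>

definition direct_sum_id :: "'a::real_inner set \<Rightarrow> ('a \<Rightarrow> 'a) \<Rightarrow> ('a \<Rightarrow> 'a) \<Rightarrow> bool" where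
  "direct_sum_id W \<rho> f \<longleftrightarrow>
     (\<forall>w\<in>W. \<forall>z\<in>orthogonal_comp W. f (w + z) = \<rho> w + z)"

definition rotational_operator :: "('a::euclidean_space \<Rightarrow> 'a) \<Rightarrow> bool" where
  "rotational_operator f \<longleftrightarrow> linear f \<and>
     ((\<exists>W \<rho>. subspace W \<and> dim W = 2 \<and> rotation_of W \<rho> \<and> direct_sum_id W \<rho> f) \<or>
      (DIM('a) = 1 \<and> f = id))"

definition reflectional_operator :: "('a::euclidean_space \<Rightarrow> 'a) \<Rightarrow> bool" where
  "reflectional_operator f \<longleftrightarrow> linear f \<and>
     (\<exists>W \<rho>. subspace W \<and> dim W = 2 \<and> reflection_of W \<rho> \<and> direct_sum_id W \<rho> f)"

text \<open>\<open>compose_upto R m\<close> is \<open>R m \<circ> \<dots> \<circ> R 2 \<circ> R 1\<close>; the value \<open>R 0\<close> is not used.\<close>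

primrec compose_upto :: "(nat \<Rightarrow> 'a \<Rightarrow> 'a) \<Rightarrow> nat \<Rightarrow> 'a \<Rightarrow> 'a" where
  "compose_upto R 0 = id"
| "compose_upto R (Suc m) = R (Suc m) \<circ> compose_upto R m"

end

(* Dividing a conformal operator by the square root of its factor gives an orthogonal
   transformation S. If S fixes the orthogonal complement of U pointwise and dim U > 2, pick a unit
   vector w in U and a planar rotation inside U that takes the preimage of w under S to w; splitting
   off this rotation on the right leaves an orthogonal transformation that fixes w as well, so the
   dimension of U drops by one. Once dim U = 2, an orthogonal transformation that fixes the
   complement of U is a planar rotation or a planar reflection. *)

theory Submission
  imports Defs
begin

section \<open>Recognizing planar rotations and reflections from an orthonormal pair\<close>

lemma linear_operator_on_span_pair:
  assumes "linear f" "f u \<in> span {u, v}" "f v \<in> span {u, v}"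
  shows "linear_operator_on (span {u, v}) f"
proof -
  have "f ` span {u, v} \<subseteq> span {u, v}"
    using assms by (simp add: linear_span_image [symmetric] span_minimal)
  then show ?thesis
    using assms(1) by (auto simp: linear_operator_on_def linear_add linear_scale)
qed

text \<open>Only the values on the plane matter for the first summand, so \<open>f\<close> can serve
  as its own restriction.\<close>

lemma direct_sum_id_self:
  assumes "linear f" "\<And>z. z \<bullet> u = 0 \<Longrightarrow> z \<bullet> v = 0 \<Longrightarrow> f z = z"
  shows "direct_sum_id (span {u, v}) f f"
proof -
  have "f z = z" if "z \<in> orthogonal_comp (span {u, v})" for z
    using that assms(2)[of z]
    by (auto simp: orthogonal_comp_def orthogonal_def inner_commute span_base)
  then show ?thesis
    using assms(1) by (simp add: direct_sum_id_def linear_add)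
qed

lemma dim_span_orthonormal_pair:
  fixes u v :: "'a::euclidean_space"
  assumes "norm u = 1" "norm v = 1" "u \<bullet> v = 0"
  shows "dim (span {u, v}) = 2"
proof -
  have "u \<noteq> v"
    using assms by auto
  moreover have "independent {u, v}"
    using assms by (intro pairwise_orthogonal_independent)
      (auto simp: pairwise_def orthogonal_def inner_commute)
  ultimately show ?thesis
    by (simp add: dim_eq_card_independent)
qed

lemma rotational_operatorI:
  fixes f :: "'a::euclidean_space \<Rightarrow> 'a"
  assumes "linear f" "norm u = 1" "norm v = 1" "u \<bullet> v = 0"
    and "f u = cos \<theta> *\<^sub>R u + sin \<theta> *\<^sub>R v"
    and "f v = (- sin \<theta>) *\<^sub>R u + cos \<theta> *\<^sub>R v"
    and "\<And>z. z \<bullet> u = 0 \<Longrightarrow> z \<bullet> v = 0 \<Longrightarrow> f z = z"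
  shows "rotational_operator f"
proof -
  have "f u \<in> span {u, v}" "f v \<in> span {u, v}"
    unfolding assms by (auto intro!: span_add span_diff span_scale intro: span_base)
  then have "linear_operator_on (span {u, v}) f"
    using assms(1) by (rule linear_operator_on_span_pair [rotated])
  then have "rotation_of (span {u, v}) f"
    using assms unfolding rotation_of_def orthonormal_basis_pair_def by blast
  moreover have "direct_sum_id (span {u, v}) f f"
    using assms by (intro direct_sum_id_self)
  ultimately show ?thesis
    using assms dim_span_orthonormal_pair[of u v] subspace_span
    unfolding rotational_operator_def by blast
qed

lemma reflectional_operatorI:
  fixes f :: "'a::euclidean_space \<Rightarrow> 'a"
  assumes "linear f" "norm u = 1" "norm v = 1" "u \<bullet> v = 0"
    and "f u = u" "f v = - v"
    and "\<And>z. z \<bullet> u = 0 \<Longrightarrow> z \<bullet> v = 0 \<Longrightarrow> f z = z"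
  shows "reflectional_operator f"
proof -
  have "f u \<in> span {u, v}" "f v \<in> span {u, v}"
    unfolding assms by (auto intro!: span_neg intro: span_base)
  then have "linear_operator_on (span {u, v}) f"
    using assms(1) by (rule linear_operator_on_span_pair [rotated])
  then have "reflection_of (span {u, v}) f"
    using assms unfolding reflection_of_def orthonormal_basis_pair_def by blast
  moreover have "direct_sum_id (span {u, v}) f f"
    using assms by (intro direct_sum_id_self)
  ultimately show ?thesis
    using assms dim_span_orthonormal_pair[of u v] subspace_span
    unfolding reflectional_operator_def by blast
qed

section \<open>An explicit planar rotation\<close>

text \<open>The correction added to \<open>x\<close> has the coefficients of the rotation matrix
  minus the identity matrix. For an orthonormal pair this rotates the plane and fixes its
  complement, yet no projection onto the complement is involved and linearity holds for arbitrary
  \<open>u\<close> and \<open>v\<close>.\<close>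

definition plane_rotation :: "'a::real_inner \<Rightarrow> 'a \<Rightarrow> real \<Rightarrow> 'a \<Rightarrow> 'a" where
  "plane_rotation u v \<theta> x = x
     + ((cos \<theta> - 1) * (x \<bullet> u) - sin \<theta> * (x \<bullet> v)) *\<^sub>R u
     + (sin \<theta> * (x \<bullet> u) + (cos \<theta> - 1) * (x \<bullet> v)) *\<^sub>R v"

lemma linear_plane_rotation: "linear (plane_rotation u v \<theta>)"
  by (rule linearI) (simp_all add: plane_rotation_def algebra_simps)

lemma plane_rotation_fst:
  assumes "norm u = 1" "u \<bullet> v = 0"
  shows "plane_rotation u v \<theta> u = cos \<theta> *\<^sub>R u + sin \<theta> *\<^sub>R v"
  using assms by (simp add: plane_rotation_def norm_eq_1 algebra_simps)

lemma plane_rotation_snd: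
  assumes "norm v = 1" "u \<bullet> v = 0"
  shows "plane_rotation u v \<theta> v = (- sin \<theta>) *\<^sub>R u + cos \<theta> *\<^sub>R v"
  using assms by (simp add: plane_rotation_def norm_eq_1 inner_commute[of v u] algebra_simps)

lemma plane_rotation_fixes: "z \<bullet> u = 0 \<Longrightarrow> z \<bullet> v = 0 \<Longrightarrow> plane_rotation u v \<theta> z = z"
  by (simp add: plane_rotation_def)

lemma rotational_operator_plane_rotation:
  fixes u v :: "'a::euclidean_space"
  assumes "norm u = 1" "norm v = 1" "u \<bullet> v = 0"
  shows "rotational_operator (plane_rotation u v \<theta>)"
  using assms
  by (intro rotational_operatorI[of _ u v \<theta>] linear_plane_rotation plane_rotation_fst
      plane_rotation_snd plane_rotation_fixes)

text \<open>In the coordinates of \<open>x\<close> and \<open>y\<close> along \<open>u\<close> and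
  \<open>v\<close>, the change of the inner product is a polynomial with the factor
  \<open>c\<^sup>2 + s\<^sup>2 - 1\<close>, which vanishes for a cosine and a sine.\<close>

lemma orthogonal_transformation_plane_rotation:
  assumes "norm u = 1" "norm v = 1" "u \<bullet> v = 0"
  shows "orthogonal_transformation (plane_rotation u v \<theta>)"
  unfolding orthogonal_transformation_def
proof (intro conjI allI linear_plane_rotation)
  fix x y
  have uv: "u \<bullet> u = 1" "v \<bullet> v = 1" "v \<bullet> u = 0"
    using assms by (simp_all add: norm_eq_1 inner_commute)
  define c s a b p q where "c = cos \<theta>" and "s = sin \<theta>"
    and "a = x \<bullet> u" and "b = x \<bullet> v" and "p = y \<bullet> u" and "q = y \<bullet> v"
  note defs = this
  have expand: "(x + A *\<^sub>R u + B *\<^sub>R v) \<bullet> (y + C *\<^sub>R u + D *\<^sub>R v) =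
      x \<bullet> y + a * C + b * D + p * A + q * B + A * C + B * D" for A B C D
    using uv assms(3)
    by (simp add: inner_add_left inner_add_right defs inner_commute[of u y] inner_commute[of v y]
        algebra_simps)
  have "plane_rotation u v \<theta> x \<bullet> plane_rotation u v \<theta> y - x \<bullet> y =
      a * ((c - 1) * p - s * q) + b * (s * p + (c - 1) * q)
      + p * ((c - 1) * a - s * b) + q * (s * a + (c - 1) * b)
      + ((c - 1) * a - s * b) * ((c - 1) * p - s * q)
      + (s * a + (c - 1) * b) * (s * p + (c - 1) * q)"
    unfolding plane_rotation_def expand by (simp add: defs)
  also have "\<dots> = (c\<^sup>2 + s\<^sup>2 - 1) * (a * p + b * q)"
    by algebra
  also have "\<dots> = 0"
    by (simp add: defs)
  finally show "plane_rotation u v \<theta> x \<bullet> plane_rotation u v \<theta> y = x \<bullet> y"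
    by simp
qed

section \<open>Unit vectors and rotations inside a subspace\<close>

lemma dim_orthogonal_in_subspace:
  fixes a :: "'a::euclidean_space"
  assumes "subspace U" "a \<in> U" "a \<noteq> 0"
  shows "dim {y \<in> U. a \<bullet> y = 0} + 1 = dim U"
proof -
  have "{y \<in> U. \<forall>x\<in>span {a}. orthogonal x y} = {y \<in> U. a \<bullet> y = 0}"
    by (auto simp: span_singleton orthogonal_def)
  moreover have "dim (span {a}) = 1"
    using assms by (simp add: dim_insert)
  ultimately show ?thesis
    using dim_subspace_orthogonal_to_vectors[of "span {a}" U] assms
    by (simp add: span_minimal)
qed

lemma unit_vector_in_subspace_exists:
  fixes U :: "'a::euclidean_space set"
  assumes "subspace U" "dim U > 0"
  obtains a where "a \<in> U" "norm a = 1"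
proof -
  obtain x where x: "x \<in> U" "x \<noteq> 0"
    using assms(2) by (metis dim_eq_0 less_irrefl singletonI subsetI)
  show thesis
  proof
    show "x /\<^sub>R norm x \<in> U"
      using x assms by (simp add: subspace_scale)
    show "norm (x /\<^sub>R norm x) = 1"
      using x by simp
  qed
qed

lemma unit_vector_orthogonal_exists:
  fixes a :: "'a::euclidean_space"
  assumes "subspace U" "a \<in> U" "norm a = 1" "dim U \<ge> 2"
  obtains v where "v \<in> U" "norm v = 1" "a \<bullet> v = 0"
proof -
  have "subspace {y \<in> U. a \<bullet> y = 0}"
    using assms(1) by (auto simp: subspace_def inner_add_right)
  moreover have "dim {y \<in> U. a \<bullet> y = 0} > 0"
    using dim_orthogonal_in_subspace[of U a] assms by fastforce
  ultimately obtain v where "v \<in> {y \<in> U. a \<bullet> y = 0}" "norm v = 1"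
    by (rule unit_vector_in_subspace_exists)
  then show thesis
    using that by blast
qed

text \<open>One Gram-Schmidt step: the part \<open>r\<close> of \<open>b\<close> orthogonal to
  \<open>a\<close> gives the direction \<open>v\<close>, and the coordinates of the unit vector
  \<open>b\<close> along \<open>a\<close> and \<open>v\<close> are the cosine and sine of the
  angle.\<close>

lemma plane_rotation_exists:
  fixes a b :: "'a::euclidean_space"
  assumes "subspace U" "dim U \<ge> 2" "a \<in> U" "b \<in> U" "norm a = 1" "norm b = 1"
  obtains v \<theta> where "v \<in> U" "norm v = 1" "a \<bullet> v = 0" "plane_rotation a v \<theta> a = b"
proof -
  define r where "r = b - (a \<bullet> b) *\<^sub>R a"
  have r: "a \<bullet> r = 0" "r \<in> U"
    using assms by (auto simp: r_def inner_diff_right norm_eq_1 subspace_diff subspace_scale)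
  obtain v where v: "v \<in> U" "norm v = 1" "a \<bullet> v = 0" "r = norm r *\<^sub>R v"
  proof (cases "r = 0")
    \<comment> \<open>Here \<open>b\<close> is \<open>a\<close> or \<open>- a\<close> and
      \<open>r\<close> yields no direction; any unit vector of \<open>U\<close> orthogonal to
      \<open>a\<close> will do, and it exists because \<open>dim U \<ge> 2\<close>.\<close>
    case True
    then show thesis
      using unit_vector_orthogonal_exists[OF assms(1,3,5,2)] that by (metis norm_zero scaleR_zero_left)
  next
    case False
    then show thesis
      using r assms by (intro that[of "r /\<^sub>R norm r"]) (auto simp: subspace_scale)
  qed
  have b: "b = (a \<bullet> b) *\<^sub>R a + norm r *\<^sub>R v"
    using v(4) by (simp add: r_def)
  have "(a \<bullet> b)\<^sup>2 + (norm r)\<^sup>2 = 1"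
  proof -
    have "r \<bullet> r = 1 - (a \<bullet> b)\<^sup>2"
      using assms by (simp add: r_def norm_eq_1 algebra_simps inner_commute power2_eq_square)
    then show ?thesis
      by (simp add: power2_norm_eq_inner)
  qed
  then obtain \<theta> where "a \<bullet> b = cos \<theta>" "norm r = sin \<theta>"
    by (rule sincos_total_2pi)
  then have "plane_rotation a v \<theta> a = b"
    using plane_rotation_fst[of a v \<theta>] assms v b by simp
  with v show thesis
    using that by blast
qed

section \<open>Orthogonal transformations of a plane\<close>

lemma orthogonal_transformation_plane:
  fixes S :: "'a::euclidean_space \<Rightarrow> 'a"
  assumes S: "orthogonal_transformation S"
    and uv: "norm u = 1" "norm v = 1" "u \<bullet> v = 0"
    and fixed: "\<And>z. z \<bullet> u = 0 \<Longrightarrow> z \<bullet> v = 0 \<Longrightarrow> S z = z"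
  shows "rotational_operator S \<or> reflectional_operator S"
proof -
  have lin: "linear S" and inn: "S x \<bullet> S y = x \<bullet> y" for x y
    using S by (auto simp: orthogonal_transformation_def)
  have uv': "u \<bullet> u = 1" "v \<bullet> v = 1" "v \<bullet> u = 0"
    using uv by (simp_all add: norm_eq_1 inner_commute)
  \<comment> \<open>The condition on \<open>x\<close> says that it lies in the plane. The component
    \<open>z\<close> of \<open>S x\<close> off the plane is fixed by \<open>S\<close>, so
    \<open>z \<bullet> S x = S z \<bullet> S x = z \<bullet> x = 0\<close>, which forces
    \<open>z = 0\<close>.\<close>
  have expand: "S x = (S x \<bullet> u) *\<^sub>R u + (S x \<bullet> v) *\<^sub>R v"
    if x: "\<And>z. z \<bullet> u = 0 \<Longrightarrow> z \<bullet> v = 0 \<Longrightarrow> z \<bullet> x = 0" for x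
  proof -
    define z where "z = S x - (S x \<bullet> u) *\<^sub>R u - (S x \<bullet> v) *\<^sub>R v"
    have z: "z \<bullet> u = 0" "z \<bullet> v = 0"
      using uv uv' by (simp_all add: z_def inner_diff_left)
    then have "z \<bullet> S x = 0"
      using inn[of z x] fixed[of z] x by simp
    then have "z \<bullet> z = 0"
      using z by (subst (2) z_def) (simp add: inner_diff_right)
    then have "z = 0"
      by simp
    then show ?thesis
      by (simp add: z_def algebra_simps)
  qed
  define p q r s where "p = S u \<bullet> u" and "q = S u \<bullet> v" and "r = S v \<bullet> u" and "s = S v \<bullet> v"
  have Su: "S u = p *\<^sub>R u + q *\<^sub>R v" and Sv: "S v = r *\<^sub>R u + s *\<^sub>R v"
    using expand[of u] expand[of v] by (auto simp: p_def q_def r_def s_def)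
  have pq: "p\<^sup>2 + q\<^sup>2 = 1"
    using inn[of u u] uv uv' by (simp add: Su inner_add_left inner_add_right power2_eq_square)
  have rs: "r\<^sup>2 + s\<^sup>2 = 1"
    using inn[of v v] uv uv' by (simp add: Sv inner_add_left inner_add_right power2_eq_square)
  have pr: "p * r + q * s = 0"
    using inn[of u v] uv uv' by (simp add: Su Sv inner_add_left inner_add_right mult.commute)
  obtain \<theta> where \<theta>: "p = cos \<theta>" "q = sin \<theta>"
    using pq by (rule sincos_total_2pi)
  \<comment> \<open>The determinant of \<open>S\<close> on the plane. Orthonormality of
    \<open>S u\<close> and \<open>S v\<close> makes \<open>S v\<close> equal to \<open>e\<close>
    times the quarter turn of \<open>S u\<close>, and the sign of \<open>e\<close> separates
    rotations from reflections.\<close>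
  define e where "e = p * s - q * r"
  have r: "r = - e * q"
    unfolding e_def using pq pr by algebra
  have s: "s = e * p"
    unfolding e_def using pq pr by algebra
  have "e\<^sup>2 = 1"
    using pq rs unfolding r s by algebra
  then consider "e = 1" | "e = -1"
    by (auto simp: power2_eq_1_iff)
  then show ?thesis
  proof cases
    case 1
    then have "rotational_operator S"
      using lin uv fixed Su Sv r s \<theta> by (intro rotational_operatorI[of S u v \<theta>]) auto
    then show ?thesis ..
  next
    case 2
    \<comment> \<open>The mirror line lies at half the angle between \<open>u\<close> and \<open>S u\<close>.\<close>
    define c d where "c = cos (\<theta> / 2)" and "d = sin (\<theta> / 2)"
    have cd: "c\<^sup>2 + d\<^sup>2 = 1" and p: "p = c\<^sup>2 - d\<^sup>2" and q: "q = 2 * c * d"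
      using cos_double[of "\<theta> / 2"] sin_double[of "\<theta> / 2"]
      by (simp_all add: c_def d_def \<theta>)
    define m k where "m = c *\<^sub>R u + d *\<^sub>R v" and "k = (- d) *\<^sub>R u + c *\<^sub>R v"
    have "norm m = 1" "norm k = 1" "m \<bullet> k = 0"
      using uv uv' cd
      by (simp_all add: m_def k_def norm_eq_1 inner_add_left inner_add_right power2_eq_square
          inner_diff_left inner_diff_right)
    moreover have "S m = m"
    proof -
      have "c * p + d * q = c" "c * q - d * p = d"
        unfolding p q using cd by algebra+
      moreover have "S m = (c * p + d * q) *\<^sub>R u + (c * q - d * p) *\<^sub>R v"
        using lin r s 2 by (simp add: m_def linear_add linear_diff linear_scale Su Sv algebra_simps)
      ultimately show ?thesis
        by (simp add: m_def)
    qed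
    moreover have "S k = - k"
    proof -
      have "- d * p + c * q = d" "- d * q - c * p = - c"
        unfolding p q using cd by algebra+
      moreover have "S k = (- d * p + c * q) *\<^sub>R u + (- d * q - c * p) *\<^sub>R v"
        using lin r s 2
        by (simp add: k_def linear_add linear_diff linear_neg linear_scale Su Sv algebra_simps)
      ultimately show ?thesis
        by (simp add: k_def)
    qed
    \<comment> \<open>The pair \<open>m\<close>, \<open>k\<close> is a rotated copy of
      \<open>u\<close>, \<open>v\<close>, so both pairs have the same orthogonal vectors.\<close>
    moreover have "S z = z" if z: "z \<bullet> m = 0" "z \<bullet> k = 0" for z
    proof (rule fixed)
      have "c * (z \<bullet> u) + d * (z \<bullet> v) = 0" "c * (z \<bullet> v) - d * (z \<bullet> u) = 0"
        using z by (simp_all add: m_def k_def inner_add_right inner_diff_right)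
      then show "z \<bullet> u = 0" "z \<bullet> v = 0"
        using cd by algebra+
    qed
    ultimately have "reflectional_operator S"
      using lin by (intro reflectional_operatorI[of S m k])
    then show ?thesis ..
  qed
qed

section \<open>Splitting off rotations by induction on the dimension\<close>

text \<open>The recursion exposes the operator applied last, whereas the induction below splits off
  the one applied first.\<close>

lemma compose_upto_Suc_right:
  "compose_upto R (Suc m) = compose_upto (\<lambda>k. R (Suc k)) m \<circ> R 1"
  by (induction m) (auto simp: fun_eq_iff)

text \<open>The ambient type cannot shrink during the induction, so a subspace \<open>U\<close>
  shrinks instead and \<open>S\<close> is kept trivial on its complement. With
  \<open>dim U = m + 2\<close>, exactly \<open>m\<close> rotations are removed before a plane is
  left.\<close>

lemma orthogonal_transformation_decomposition:
  fixes S :: "'a::euclidean_space \<Rightarrow> 'a"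
  assumes "orthogonal_transformation S" "subspace U" "dim U = m + 2"
    and "\<And>z. (\<And>y. y \<in> U \<Longrightarrow> z \<bullet> y = 0) \<Longrightarrow> S z = z"
  shows "\<exists>Q R. S = Q \<circ> compose_upto R m \<and>
           (\<forall>k\<in>{1..m}. rotational_operator (R k)) \<and>
           (rotational_operator Q \<or> reflectional_operator Q)"
  using assms
proof (induction m arbitrary: S U)
  case 0
  obtain u where u: "u \<in> U" "norm u = 1"
    using unit_vector_in_subspace_exists[of U] 0 by auto
  obtain v where v: "v \<in> U" "norm v = 1" "u \<bullet> v = 0"
    using unit_vector_orthogonal_exists[of U u] u 0 by auto
  have "span {u, v} = U"
    using u v 0 dim_span_orthonormal_pair[of u v]
    by (intro subspace_dim_equal) (auto simp: span_minimal)
  have "S z = z" if z: "z \<bullet> u = 0" "z \<bullet> v = 0" for z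
  proof (rule 0)
    fix y
    assume "y \<in> U"
    then have "y \<in> span {u, v}"
      using \<open>span {u, v} = U\<close> by simp
    then obtain k l where "y - k *\<^sub>R u = l *\<^sub>R v"
      by (auto simp: span_breakdown_eq span_singleton)
    then have "y = k *\<^sub>R u + l *\<^sub>R v"
      by (simp add: algebra_simps)
    then show "z \<bullet> y = 0"
      using z by (simp add: inner_add_right)
  qed
  then have "rotational_operator S \<or> reflectional_operator S"
    using 0 u v by (intro orthogonal_transformation_plane)
  then show ?case
    by (intro exI[of _ S]) auto
next
  case (Suc m)
  obtain w where w: "w \<in> U" "norm w = 1"
    using unit_vector_in_subspace_exists[of U] Suc.prems by auto
  have bijS: "bij S"
    using Suc.prems(1) by (rule orthogonal_transformation_bij)
  define a where "a = inv S w"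
  have Sa: "S a = w"
    using bijS by (simp add: a_def bij_is_surj surj_f_inv_f)
  have "norm a = 1"
    using Sa w Suc.prems(1) by (metis orthogonal_transformation_norm)
  \<comment> \<open>\<open>S\<close> fixes each \<open>z\<close> in the complement of
    \<open>U\<close>, so \<open>z \<bullet> a = S z \<bullet> S a = z \<bullet> w = 0\<close>; hence
    \<open>a\<close> lies in the double complement, which is \<open>U\<close>.\<close>
  have "a \<in> U"
  proof -
    have "z \<bullet> a = 0" if "z \<in> orthogonal_comp U" for z
    proof -
      have z: "z \<bullet> y = 0" if "y \<in> U" for y
        using \<open>z \<in> orthogonal_comp U\<close> that
        by (auto simp: orthogonal_comp_def orthogonal_def inner_commute)
      then have "S z = z"
        by (rule Suc.prems(4))
      then have "z \<bullet> a = z \<bullet> w"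
        using Suc.prems(1) Sa by (metis orthogonal_transformation_def)
      then show ?thesis
        using z w by simp
    qed
    then have "a \<in> orthogonal_comp (orthogonal_comp U)"
      by (auto simp: orthogonal_comp_def orthogonal_def)
    then show ?thesis
      using Suc.prems(2) by (simp add: orthogonal_comp_self)
  qed
  obtain v \<theta> where v: "v \<in> U" "norm v = 1" "a \<bullet> v = 0" and rot: "plane_rotation a v \<theta> a = w"
    using plane_rotation_exists[of U a w] Suc.prems w \<open>a \<in> U\<close> \<open>norm a = 1\<close> by auto
  define P where "P = plane_rotation a v \<theta>"
  have P: "orthogonal_transformation P" "rotational_operator P"
    using v \<open>norm a = 1\<close>
    by (simp_all add: P_def orthogonal_transformation_plane_rotation
        rotational_operator_plane_rotation)
  have bijP: "bij P"
    using P(1) by (rule orthogonal_transformation_bij)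
  define S' where "S' = S \<circ> inv P"
  have SS': "S = S' \<circ> P"
    using bijP by (simp add: S'_def comp_assoc bij_is_inj)
  have S': "orthogonal_transformation S'"
    unfolding S'_def
    by (intro orthogonal_transformation_compose orthogonal_transformation_inv P Suc.prems)
  \<comment> \<open>Both \<open>P\<close> and \<open>S\<close> send \<open>a\<close> to
    \<open>w\<close>.\<close>
  have "S' w = w"
    using SS' Sa rot by (metis P_def comp_apply)
  define U' where "U' = {y \<in> U. w \<bullet> y = 0}"
  have "subspace U'"
    using Suc.prems(2) by (auto simp: U'_def subspace_def inner_add_right)
  moreover have "dim U' = m + 2"
    using dim_orthogonal_in_subspace[of U w] Suc.prems w by (fastforce simp: U'_def)
  \<comment> \<open>Such a \<open>z\<close> is a multiple of \<open>w\<close> plus a vector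
    \<open>t\<close> orthogonal to \<open>U\<close>. \<open>P\<close> fixes \<open>t\<close> because
    its plane lies in \<open>U\<close>, and \<open>S\<close> fixes \<open>t\<close> by hypothesis,
    so \<open>S'\<close> fixes both summands.\<close>
  moreover have "S' z = z" if z: "\<And>y. y \<in> U' \<Longrightarrow> z \<bullet> y = 0" for z
  proof -
    define t where "t = z - (z \<bullet> w) *\<^sub>R w"
    have t: "t \<bullet> y = 0" if "y \<in> U" for y
    proof -
      have "y - (y \<bullet> w) *\<^sub>R w \<in> U'"
        using that w Suc.prems(2)
        by (simp add: U'_def subspace_diff subspace_scale inner_diff_right norm_eq_1 inner_commute)
      from z[OF this] show ?thesis
        by (simp add: t_def inner_diff_left inner_diff_right inner_commute)
    qed
    have "P t = t"
      unfolding P_def using t v \<open>a \<in> U\<close> by (intro plane_rotation_fixes)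
    moreover have "S t = t"
      using t by (rule Suc.prems(4))
    ultimately have "S' t = t"
      using SS' by (metis comp_apply)
    moreover have "z = t + (z \<bullet> w) *\<^sub>R w"
      by (simp add: t_def)
    ultimately show ?thesis
      using \<open>S' w = w\<close> orthogonal_transformation_linear[OF S']
      by (metis linear_add linear_scale)
  qed
  ultimately obtain Q R where QR: "S' = Q \<circ> compose_upto R m"
    "\<forall>k\<in>{1..m}. rotational_operator (R k)" "rotational_operator Q \<or> reflectional_operator Q"
    using Suc.IH[OF S'] by blast
  \<comment> \<open>\<open>P\<close> acts first and gets index 1, the operators of \<open>R\<close>
    move up by one, and \<open>id\<close> fills the index 0 that \<open>compose_upto\<close> never
    reads.\<close>
  define R' where "R' = case_nat id (case_nat P (\<lambda>k. R (Suc k)))"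
  have shift: "compose_upto (\<lambda>k. R' (Suc k)) j = compose_upto R j" for j
    by (induction j) (simp_all add: R'_def)
  have "S = Q \<circ> compose_upto R' (Suc m)"
    by (simp only: compose_upto_Suc_right shift SS' QR(1) comp_assoc) (simp add: R'_def)
  moreover have "rotational_operator (R' k)" if "k \<in> {1..Suc m}" for k
    using that P(2) QR(2) by (auto simp: R'_def split: nat.split)
  ultimately show ?case
    using QR(3) by blast
qed

section \<open>From conformal to orthogonal, and dimension one\<close>

lemma conformal_eq_scaled_orthogonal_transformation:
  assumes "conformal T"
  obtains r S where "T = (\<lambda>x. r *\<^sub>R x) \<circ> S" "orthogonal_transformation S"
proof -
  obtain c where lin: "linear T" and c: "c > 0" and inn: "\<And>u v. T u \<bullet> T v = c * (u \<bullet> v)"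
    using assms by (auto simp: conformal_def)
  show thesis
  proof
    show "T = (\<lambda>x. sqrt c *\<^sub>R x) \<circ> (\<lambda>x. (1 / sqrt c) *\<^sub>R T x)"
      using c by (simp add: fun_eq_iff)
    show "orthogonal_transformation (\<lambda>x. (1 / sqrt c) *\<^sub>R T x)"
      using c inn linear_compose_scale_right[OF lin] by (simp add: orthogonal_transformation_def)
  qed
qed

text \<open>Dimension one offers no plane to end the induction with. There \<open>T\<close> itself
  becomes the scalar factor and the identity counts as rotational by convention.\<close>

lemma linear_eq_scale_if_DIM_1:
  fixes T :: "'a::euclidean_space \<Rightarrow> 'a"
  assumes "linear T" "DIM('a) = 1"
  obtains r where "T = (\<lambda>x. r *\<^sub>R x)"
proof -
  obtain b :: 'a where b: "Basis = {b}"
    using assms(2) by (auto simp: card_1_singleton_iff)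
  have rep: "x = (x \<bullet> b) *\<^sub>R b" for x
    using euclidean_representation[of x] unfolding b by simp
  have "T x = (T b \<bullet> b) *\<^sub>R x" for x
  proof -
    have "T x = (x \<bullet> b) *\<^sub>R T b"
      using rep[of x] assms(1) by (metis linear_scale)
    also have "\<dots> = (x \<bullet> b) *\<^sub>R (T b \<bullet> b) *\<^sub>R b"
      using rep[of "T b"] by simp
    also have "\<dots> = (T b \<bullet> b) *\<^sub>R x"
      by (metis rep scaleR_left_commute)
    finally show ?thesis .
  qed
  then show thesis
    using that by blast
qed

theorem theorem5p1:
  fixes T :: "'a::euclidean_space \<Rightarrow> 'a" and n :: nat
  assumes "n = DIM('a)"
    and "in_GL T"
    and "conformal T"
  shows "\<exists>D Q R. T = D \<circ> Q \<circ> compose_upto R (n - 2) \<and>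
           (\<forall>k\<in>{1..n - 2}. rotational_operator (R k)) \<and>
           (rotational_operator Q \<or> reflectional_operator Q) \<and>
           scalar_operator D"
proof (cases "n = 1")
  case True
  have "linear T"
    using assms(3) by (simp add: conformal_def)
  then obtain r where "T = (\<lambda>x. r *\<^sub>R x)"
    using True assms(1) linear_eq_scale_if_DIM_1[of T] by auto
  then have "scalar_operator T"
    by (auto simp: scalar_operator_def)
  moreover have "rotational_operator (id :: 'a \<Rightarrow> 'a)"
    using True assms(1) by (simp add: rotational_operator_def linear_id)
  \<comment> \<open>Truncated subtraction gives \<open>n - 2 = 0\<close>, so the composition is
    empty.\<close>
  ultimately show ?thesis
    using True by (intro exI[of _ T] exI[of _ id]) auto
next
  case False
  then have n: "DIM('a) = n - 2 + 2"
    using assms(1) DIM_positive[where 'a = 'a] by linarith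
  obtain r S where T: "T = (\<lambda>x. r *\<^sub>R x) \<circ> S" and S: "orthogonal_transformation S"
    using assms(3) by (rule conformal_eq_scaled_orthogonal_transformation)
  \<comment> \<open>A vector orthogonal to the whole space is orthogonal to itself, hence
    zero.\<close>
  have "S z = z" if "\<And>y. y \<in> UNIV \<Longrightarrow> z \<bullet> y = 0" for z
    using that[of z] linear_0[OF orthogonal_transformation_linear[OF S]] by simp
  then obtain Q R where "S = Q \<circ> compose_upto R (n - 2)"
    "\<forall>k\<in>{1..n - 2}. rotational_operator (R k)" "rotational_operator Q \<or> reflectional_operator Q"
    using orthogonal_transformation_decomposition[OF S subspace_UNIV, of "n - 2"] n
    by auto
  then show ?thesis
    using T by (intro exI[of _ "\<lambda>x. r *\<^sub>R x"] exI[of _ Q] exI[of _ R])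
      (auto simp: comp_assoc scalar_operator_def)
qed

end
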